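(* Let $S$ be a generic subspace of $\mathbb{C}^n$ and let $v^j,v^k$ be linearly independent principal standard vectors of $S$ that are not orthogonal. Let $v^{j\curvearrowright k}:[0,\pi/2]\to S$ be the curve defined in the context and $m_S$ the moment of $S$. Then $|v^{j\curvearrowright k}(t)|^2$ is an extremal point of $m_S$ for every $t\in[0,\pi/2)$. Moreover, if $s|w|^2+(1-s)|z|^2=|v^{j\curvearrowright k}(t_0)|^2$ with $0<s<1$, $w,z\in S$, $\|w\|=\|z\|=1$ and $t_0\in[0,\pi/2)$, then $w$ and $z$ must be (complex scalar) multiples of $v^{j\curvearrowright k}(t_0)$.
   Context: Fix an orthonormal basis $E=\{e_1,\dots,e_n\}$ of $\mathbb{C}^n$; the inner product is linear in the first variable. For $x\in\mathbb{C}^n$, $x_i=\langle x,e_i\rangle$ and $|x|^2=(|x_1|^2,\dots,|x_n|^2)$. For a subspace $S$ ($\{0\}\subsetneq S\subsetneq\mathbb{C}^n$) with orthogonal projection $P_S$, the moment is $m_S=\operatorname{conv}\{|v|^2:v\in S,\ \|v\|=1\}$. $S$ is generic (with respect to $E$) if for every $i$ there is $x\in S$ with $x_i\ne0$; equivalently $P_Se_i\neq0$ for all $i$. The principal standard vectors of $S$ are $v^i=P_Se_i/\|P_Se_i\|\in S$, $i=1,\dots,n$, with coordinates $v^i_l=\langle v^i,e_l\rangle$. For $v^j,v^k$ linearly independent, $$v^{j\curvearrowright k}(t)=\cos(t)\,v^j+\sin(t)\,e^{i\arg(v^j_k)}\,\frac{v^k-\langle v^k,v^j\rangle v^j}{\|v^k-\langle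 v^k,v^j\rangle v^j\|},\quad t\in[0,\pi/2],$$ where $i$ in the exponent is the imaginary unit. *)

theory Defs
  imports "HOL-Analysis.Analysis"
begin

text \<open>The inner product already present on \<open>complex ^ 'n\<close> is the real one (the real part of
  \<open>hinner\<close>), so the Hermitian inner product is introduced here; it is linear in the first
  variable, and the library norm on \<open>complex ^ 'n\<close> is the norm it induces.\<close>

definition hinner :: "complex ^ 'n \<Rightarrow> complex ^ 'n \<Rightarrow> complex" where
  "hinner x y = (\<Sum>l\<in>UNIV. x $ l * cnj (y $ l))"

definition orthonormal_basis :: "('n \<Rightarrow> complex ^ 'n) \<Rightarrow> bool" where
  "orthonormal_basis E \<longleftrightarrow>
     (\<forall>i j. hinner (E i) (E j) = (if i = j then 1 else 0)) \<and> vec.span (range E) = UNIV"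

text \<open>Coordinates are taken with respect to the basis \<open>E\<close>, not to the standard basis underlying
  the type \<open>complex ^ 'n\<close>.\<close>

definition coord :: "('n \<Rightarrow> complex ^ 'n) \<Rightarrow> complex ^ 'n \<Rightarrow> 'n \<Rightarrow> complex" where
  "coord E x i = hinner x (E i)"

definition sq_mod :: "('n \<Rightarrow> complex ^ 'n) \<Rightarrow> complex ^ 'n \<Rightarrow> real ^ 'n" where
  "sq_mod E x = (\<chi> i. (cmod (coord E x i))\<^sup>2)"

definition moment :: "('n \<Rightarrow> complex ^ 'n) \<Rightarrow> (complex ^ 'n) set \<Rightarrow> (real ^ 'n) set" where
  "moment E S = convex hull {sq_mod E v |v. v \<in> S \<and> norm v = 1}"

definition generic :: "('n \<Rightarrow> complex ^ 'n) \<Rightarrow> (complex ^ 'n) set \<Rightarrow> bool" where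
  "generic E S \<longleftrightarrow> (\<forall>i. \<exists>x\<in>S. coord E x i \<noteq> 0)"

text \<open>Only meaningful when \<open>S\<close> is a complex subspace: the described vector then exists and is
  unique.\<close>

definition orth_proj :: "(complex ^ 'n) set \<Rightarrow> complex ^ 'n \<Rightarrow> complex ^ 'n" where
  "orth_proj S x = (THE y. y \<in> S \<and> (\<forall>u\<in>S. hinner (x - y) u = 0))"

definition principal_vec ::
    "('n \<Rightarrow> complex ^ 'n) \<Rightarrow> (complex ^ 'n) set \<Rightarrow> 'n \<Rightarrow> complex ^ 'n" where
  "principal_vec E S i = orth_proj S (E i) /\<^sub>R norm (orth_proj S (E i))"

definition principal_curve ::
    "('n \<Rightarrow> complex ^ 'n) \<Rightarrow> (complex ^ 'n) set \<Rightarrow> 'n \<Rightarrow> 'n \<Rightarrow> real \<Rightarrow> complex ^ 'n" where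
  "principal_curve E S j k t =
     (let vj = principal_vec E S j;
          vk = principal_vec E S k;
          u = vk - hinner vk vj *s vj
      in cos t *\<^sub>R vj + sin t *\<^sub>R (exp (\<i> * of_real (Arg (coord E vj k))) *s (u /\<^sub>R norm u)))"

end

theory Submission
  imports Defs
begin

text \<open>On \<open>S\<close> one has \<open>|x\<^sub>j| = \<parallel>P\<^sub>S e\<^sub>j\<parallel> |\<langle>x, v\<^sup>j\<rangle>|\<close>. Write \<open>|\<langle>v\<^sup>j, v\<^sup>k\<rangle>| = cos \<phi>\<close> with
  \<open>0 < \<phi> < \<pi>/2\<close>. The functional \<open>sin(2\<phi> - 2t) |\<langle>x, v\<^sup>j\<rangle>|\<^sup>2 + sin(2t) |\<langle>x, v\<^sup>k\<rangle>|\<^sup>2\<close> is a linear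
  function of \<open>|x|\<^sup>2\<close>, and its difference from \<open>2 sin \<phi> cos t cos(\<phi> - t) \<parallel>x\<parallel>\<^sup>2\<close> is a sum of two
  squares with positive weights that vanish simultaneously only on the line of the curve point.
  Hence the curve point spans the set of maximisers and its image is an exposed point of the
  moment.\<close>

section \<open>Sesquilinear calculus for \<open>hinner\<close> and its relation to the library
  norm\<close>

lemma hinner_add_left: "hinner (x + y) z = hinner x z + hinner y z"
  by (simp add: hinner_def distrib_right sum.distrib)

lemma hinner_diff_left: "hinner (x - y) z = hinner x z - hinner y z"
  by (simp add: hinner_def left_diff_distrib sum_subtractf)

lemma hinner_scale_left: "hinner (c *s x) z = c * hinner x z"
  by (simp add: hinner_def sum_distrib_left mult.assoc)

lemma hinner_commute: "hinner x y = cnj (hinner y x)"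
  by (simp add: hinner_def mult.commute)

lemma hinner_add_right: "hinner z (x + y) = hinner z x + hinner z y"
  by (simp add: hinner_def distrib_left sum.distrib)

lemma hinner_diff_right: "hinner z (x - y) = hinner z x - hinner z y"
  by (simp add: hinner_def right_diff_distrib sum_subtractf)

lemma hinner_scale_right: "hinner z (c *s x) = cnj c * hinner z x"
  by (simp add: hinner_def sum_distrib_left mult_ac)

lemma scaleR_eq_scale: "r *\<^sub>R (x :: complex ^ 'n) = of_real r *s x"
  by (simp add: vec_eq_iff) (simp add: scaleR_conv_of_real)

lemmas hinner_simps = hinner_add_left hinner_diff_left hinner_scale_left
  hinner_add_right hinner_diff_right hinner_scale_right

lemma inner_eq_Re_hinner: "x \<bullet> y = Re (hinner x y)"
  by (simp add: inner_vec_def hinner_def inner_complex_def)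

lemma hinner_self: "hinner x x = of_real ((norm x)\<^sup>2)"
proof (rule complex_eqI)
  show "Re (hinner x x) = Re (of_real ((norm x)\<^sup>2))"
    by (simp add: inner_eq_Re_hinner[symmetric] power2_norm_eq_inner)
  have "Im (hinner x x) = 0"
    using hinner_commute[of x x] by (simp add: complex_eq_iff)
  then show "Im (hinner x x) = Im (of_real ((norm x)\<^sup>2))" by simp
qed

lemma norm_scale: "norm (c *s (x :: complex ^ 'n)) = cmod c * norm x"
proof -
  have "complex_of_real ((norm (c *s x))\<^sup>2) = of_real ((cmod c * norm x)\<^sup>2)"
    unfolding hinner_self[symmetric] hinner_simps
    by (simp add: hinner_self power_mult_distrib) (metis complex_norm_square mult.commute of_real_power)
  then show ?thesis
    using power2_eq_iff_nonneg[of "norm (c *s x)" "cmod c * norm x"]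
    by (simp only: of_real_eq_iff) simp
qed

lemma sq_mod_scale: "cmod c = 1 \<Longrightarrow> sq_mod E (c *s x) = sq_mod E x"
  by (simp add: sq_mod_def coord_def hinner_scale_left norm_mult)

section \<open>Orthogonal projection and principal standard vectors\<close>

text \<open>A complex subspace is also a real one, so the real orthogonal decomposition supplies the
  vector that the \<open>THE\<close> refers to; only its Hermitian orthogonality and its uniqueness
  remain to be checked.\<close>

lemma orth_proj_works:
  fixes S :: "(complex ^ 'n::finite) set"
  assumes S: "vec.subspace S"
  shows "orth_proj S x \<in> S \<and> (\<forall>u\<in>S. hinner (x - orth_proj S x) u = 0)"
proof -
  have rS: "subspace S"
    by (simp add: subspace_def scaleR_eq_scale vec.subspace_0[OF S] vec.subspace_add[OF S]
        vec.subspace_scale[OF S])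
  obtain y z where y: "y \<in> span S" and z: "\<And>w. w \<in> span S \<Longrightarrow> orthogonal z w" and x: "x = y + z"
    using orthogonal_subspace_decomp_exists by metis
  have yS: "y \<in> S" using y span_eq_iff[THEN iffD2, OF rS] by simp
  have "hinner z u = 0" if "u \<in> S" for u
  proof -
    have "Re (hinner z u) = 0"
      using z[of u] that by (simp add: orthogonal_def inner_eq_Re_hinner span_base)
    \<comment> \<open>The real part of \<open>hinner z (\<i> *s u)\<close> is the imaginary part of
      \<open>hinner z u\<close>, so closure of \<open>S\<close> under \<open>\<i>\<close> upgrades
      real orthogonality to Hermitian orthogonality.\<close>
    moreover have "Re (hinner z (\<i> *s u)) = 0"
      using z[of "\<i> *s u"] vec.subspace_scale[OF S that]
      by (simp add: orthogonal_def inner_eq_Re_hinner span_base)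
    ultimately show ?thesis
      by (simp add: hinner_scale_right complex_eq_iff)
  qed
  then have ex: "y \<in> S \<and> (\<forall>u\<in>S. hinner (x - y) u = 0)"
    using yS x by simp
  have uniq: "y' = y" if y': "y' \<in> S \<and> (\<forall>u\<in>S. hinner (x - y') u = 0)" for y'
  proof -
    have d: "y' - y \<in> S" using y' yS vec.subspace_diff[OF S] by blast
    \<comment> \<open>The difference of two candidates lies in \<open>S\<close> and is orthogonal to
      \<open>S\<close>, hence to itself.\<close>
    have "hinner (y' - y) (y' - y) = hinner (x - y) (y' - y) - hinner (x - y') (y' - y)"
      by (simp add: hinner_diff_left)
    also have "\<dots> = 0" using d ex y' by simp
    finally show ?thesis by (simp add: hinner_self)
  qed
  show ?thesis
    unfolding orth_proj_def by (rule theI, rule ex, rule uniq)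
qed

lemma coord_eq_hinner_orth_proj:
  assumes "vec.subspace S" "x \<in> S"
  shows "coord E x i = hinner x (orth_proj S (E i))"
proof -
  have "hinner (E i - orth_proj S (E i)) x = 0"
    using orth_proj_works[OF assms(1)] assms(2) by blast
  then have "hinner x (E i - orth_proj S (E i)) = 0"
    by (metis hinner_commute complex_cnj_zero)
  then show ?thesis by (simp add: coord_def hinner_diff_right)
qed

lemma norm_orth_proj_pos:
  assumes "vec.subspace S" "generic E S"
  shows "norm (orth_proj S (E i)) > 0"
proof -
  obtain x where "x \<in> S" "coord E x i \<noteq> 0" using assms(2) by (auto simp: generic_def)
  then have "hinner x (orth_proj S (E i)) \<noteq> 0"
    using coord_eq_hinner_orth_proj[OF assms(1)] by metis
  then show ?thesis by (auto simp: hinner_def)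
qed

lemma principal_vec_in:
  assumes "vec.subspace S" shows "principal_vec E S i \<in> S"
  using orth_proj_works[OF assms] vec.subspace_scale[OF assms]
  by (simp add: principal_vec_def scaleR_eq_scale)

lemma norm_principal_vec:
  assumes "vec.subspace S" "generic E S"
  shows "norm (principal_vec E S i) = 1"
  using norm_orth_proj_pos[OF assms, of i] by (simp add: principal_vec_def)

text \<open>Up to a positive factor, \<open>principal_vec E S i\<close> represents the coordinate
  functional on \<open>S\<close>. This makes squared moduli of inner products with principal vectors
  linear in \<open>sq_mod E x\<close>.\<close>

lemma coord_eq_hinner_principal_vec:
  assumes "vec.subspace S" "generic E S" "x \<in> S"
  shows "coord E x i = of_real (norm (orth_proj S (E i))) * hinner x (principal_vec E S i)"
  using norm_orth_proj_pos[OF assms(1,2), of i]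
  by (simp add: coord_eq_hinner_orth_proj[OF assms(1,3)] principal_vec_def scaleR_eq_scale
      hinner_scale_right)

section \<open>Pythagoras for an orthonormal pair and the quadratic form identity\<close>

text \<open>The residual is kept as an exact term instead of being dropped as in Bessel's
  inequality: its vanishing is what later places a maximiser in the span of \<open>p\<close> and
  \<open>q\<close>.\<close>

lemma norm_orthonormal_decomposition:
  fixes x p q :: "complex ^ 'n"
  assumes "norm p = 1" "norm q = 1" "hinner p q = 0"
  defines "a \<equiv> hinner x p" and "b \<equiv> hinner x q"
  shows "(norm x)\<^sup>2 = (cmod a)\<^sup>2 + (cmod b)\<^sup>2 + (norm (x - a *s p - b *s q))\<^sup>2"
proof -
  have pq: "hinner q p = 0" "hinner p x = cnj a" "hinner q x = cnj b"
    using assms hinner_commute[of q p] hinner_commute[of p x] hinner_commute[of q x] by auto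
  have "hinner (x - a *s p - b *s q) (x - a *s p - b *s q)
      = hinner x x - a * cnj a - b * cnj b"
    using assms(1-3) pq
    by (simp add: hinner_simps hinner_self[of p] hinner_self[of q] a_def[symmetric]
        b_def[symmetric] algebra_simps)
  then have "complex_of_real ((norm (x - a *s p - b *s q))\<^sup>2)
      = of_real ((norm x)\<^sup>2 - (cmod a)\<^sup>2 - (cmod b)\<^sup>2)"
    by (simp only: hinner_self complex_norm_square of_real_diff)
  then have "(norm (x - a *s p - b *s q))\<^sup>2 = (norm x)\<^sup>2 - (cmod a)\<^sup>2 - (cmod b)\<^sup>2"
    by (simp only: of_real_eq_iff)
  then show ?thesis by simp
qed

text \<open>With \<open>r = cos \<phi>\<close>, \<open>d = sin \<phi>\<close>, \<open>c = cos t\<close> and \<open>s = sin t\<close>, the coefficient of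
  \<open>(cmod a)\<^sup>2\<close> on the right is \<open>sin (2 * \<phi> - 2 * t)\<close>.\<close>

lemma quadratic_form_identity:
  fixes a b :: complex and r d c s :: real
  shows "2 * d * c * (r * c + d * s) * ((cmod a)\<^sup>2 + (cmod b)\<^sup>2)
    = (2 * r * d * (c\<^sup>2 - s\<^sup>2) - 2 * (r\<^sup>2 - d\<^sup>2) * s * c) * (cmod a)\<^sup>2
      + 2 * s * c * (cmod (of_real r * a + of_real d * b))\<^sup>2
      + 2 * r * d * (cmod (of_real s * a - of_real c * b))\<^sup>2"
  unfolding cmod_power2 by (simp add: algebra_simps power2_eq_square)

section \<open>Exposed points of convex hulls\<close>

text \<open>An open half-space stays convex when a single boundary point \<open>p\<close> is added.
  The enlarged set contains \<open>T\<close>, hence its hull, so \<open>f\<close> attains its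
  maximum over the hull only at \<open>p\<close>.\<close>

lemma exposed_point_convex_hull:
  fixes f :: "'a::real_inner"
  assumes "p \<in> T" and le: "\<And>y. y \<in> T \<Longrightarrow> f \<bullet> y \<le> f \<bullet> p"
    and eq: "\<And>y. y \<in> T \<Longrightarrow> f \<bullet> y = f \<bullet> p \<Longrightarrow> y = p"
  shows "p extreme_point_of convex hull T"
proof -
  let ?C = "insert p {y. f \<bullet> y < f \<bullet> p}"
  have "convex ?C"
  proof (rule convexI)
    fix x y and u v :: real
    assume x: "x \<in> ?C" and y: "y \<in> ?C" and uv: "0 \<le> u" "0 \<le> v" "u + v = 1"
    show "u *\<^sub>R x + v *\<^sub>R y \<in> ?C"
    proof (cases "u *\<^sub>R x + v *\<^sub>R y = p")
      case False
      have m: "f \<bullet> (u *\<^sub>R x + v *\<^sub>R y) = f \<bullet> p - u * (f \<bullet> p - f \<bullet> x) - v * (f \<bullet> p - f \<bullet> y)"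
      proof -
        have v: "v = 1 - u" using uv(3) by simp
        show ?thesis unfolding v by (simp add: inner_add_right algebra_simps)
      qed
      have n: "0 \<le> u * (f \<bullet> p - f \<bullet> x)" "0 \<le> v * (f \<bullet> p - f \<bullet> y)"
        using x y uv by (auto intro!: mult_nonneg_nonneg)
      \<comment> \<open>If both weighted deficits vanished, every endpoint with nonzero weight would
        be \<open>p\<close>, and so would the combination.\<close>
      have "0 < u * (f \<bullet> p - f \<bullet> x) \<or> 0 < v * (f \<bullet> p - f \<bullet> y)"
      proof (rule ccontr)
        assume "\<not> ?thesis"
        then have "u * (f \<bullet> p - f \<bullet> x) = 0" "v * (f \<bullet> p - f \<bullet> y) = 0" using n by auto
        then have "u = 0 \<or> x = p" "v = 0 \<or> y = p" using x y by auto
        then show False using False uv(3) by (auto simp flip: scaleR_add_left)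
      qed
      then show ?thesis using m n by auto
    qed simp
  qed
  moreover have "T \<subseteq> ?C" using le eq by (auto simp: less_le)
  ultimately have sub: "convex hull T \<subseteq> ?C" by (rule hull_minimal[rotated])
  show ?thesis
    unfolding extreme_point_of_def
  proof (intro conjI ballI notI)
    show "p \<in> convex hull T" using assms(1) by (rule hull_inc)
    fix a b assume "a \<in> convex hull T" "b \<in> convex hull T" and o: "p \<in> open_segment a b"
    then have ab: "a \<in> ?C" "b \<in> ?C" using sub by auto
    obtain u where u: "0 < u" "u < 1" "p = (1 - u) *\<^sub>R a + u *\<^sub>R b" and "a \<noteq> b"
      using o by (auto simp: in_segment)
    have "f \<bullet> p = (1 - u) * (f \<bullet> a) + u * (f \<bullet> b)"
      by (subst u(3)) (simp add: inner_add_right)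
    then have "(1 - u) * (f \<bullet> p - f \<bullet> a) + u * (f \<bullet> p - f \<bullet> b) = 0"
      by (simp add: algebra_simps)
    moreover have "0 \<le> (1 - u) * (f \<bullet> p - f \<bullet> a)" "0 \<le> u * (f \<bullet> p - f \<bullet> b)"
      using ab u(1,2) by (auto intro!: mult_nonneg_nonneg)
    ultimately have "(1 - u) * (f \<bullet> p - f \<bullet> a) = 0" "u * (f \<bullet> p - f \<bullet> b) = 0" by linarith+
    then have "f \<bullet> a = f \<bullet> p" "f \<bullet> b = f \<bullet> p" using u(1,2) by (simp_all add: mult_eq_0_iff)
    then have "a = p" "b = p" using ab by (metis insertE mem_Collect_eq less_irrefl)+
    then show False using \<open>a \<noteq> b\<close> by simp
  qed
qed

section \<open>The supporting functional at a curve point\<close>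

lemma principal_curve_supporting_functional:
  fixes E :: "'n::finite \<Rightarrow> complex ^ 'n"
  assumes S: "vec.subspace S" and gen: "generic E S"
    and ne: "principal_vec E S j \<noteq> principal_vec E S k"
    and ind: "vec.independent {principal_vec E S j, principal_vec E S k}"
    and nz: "hinner (principal_vec E S j) (principal_vec E S k) \<noteq> 0"
    and t: "t \<in> {0..<pi/2}"
  defines "y \<equiv> principal_curve E S j k t"
  obtains f where "y \<in> S" "norm y = 1"
    "\<forall>x\<in>S. norm x = 1 \<longrightarrow> f \<bullet> sq_mod E x \<le> f \<bullet> sq_mod E y"
    "\<forall>x\<in>S. norm x = 1 \<longrightarrow> f \<bullet> sq_mod E x = f \<bullet> sq_mod E y \<longrightarrow> (\<exists>c. x = c *s y)"
proof -
  define p where "p = principal_vec E S j"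
  define v where "v = principal_vec E S k"
  define h where "h = hinner p v"
  define r where "r = cmod h"
  define u where "u = v - hinner v p *s p"
  define d where "d = norm u"
  define e where "e = exp (\<i> * of_real (Arg (coord E p k)))"
  define q where "q = e *s (u /\<^sub>R d)"
  define c where "c = cos t"
  define s where "s = sin t"
  define nj where "nj = norm (orth_proj S (E j))"
  define nk where "nk = norm (orth_proj S (E k))"
  have pS: "p \<in> S" and vS: "v \<in> S" unfolding p_def v_def by (rule principal_vec_in[OF S])+
  have np: "norm p = 1" and nv: "norm v = 1"
    unfolding p_def v_def by (rule norm_principal_vec[OF S gen])+
  have njk: "nj > 0" "nk > 0"
    unfolding nj_def nk_def by (rule norm_orth_proj_pos[OF S gen])+
  have y: "y = of_real c *s p + of_real s *s q"
    by (simp add: y_def principal_curve_def Let_def p_def v_def u_def d_def e_def q_def c_def s_def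
        scaleR_eq_scale)
  \<comment> \<open>Excluding \<open>t = pi/2\<close> gives \<open>c > 0\<close>, on which
    \<open>M > 0\<close> and the final division by \<open>c\<close> rest.\<close>
  have c: "c > 0" and s: "s \<ge> 0" and cs: "c\<^sup>2 + s\<^sup>2 = 1"
    using t by (auto simp: c_def s_def intro!: cos_gt_zero_pi sin_ge_zero)
  have r: "r > 0" using nz by (simp add: r_def h_def p_def v_def)
  have "u \<noteq> 0"
  proof
    assume "u = 0"
    then have "v = hinner v p *s p" by (simp add: u_def)
    then have "v \<in> vec.span {p}"
      using vec.span_scale[OF vec.span_base[of p "{p}"], of "hinner v p"] by simp
    \<comment> \<open>Distinctness matters because independence is stated for a set, which would
      collapse to a singleton if \<open>p = v\<close>.\<close>
    moreover have "{p, v} - {v} = {p}" using ne by (auto simp: p_def v_def)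
    ultimately have "vec.dependent {p, v}"
      unfolding vec.dependent_def by (intro bexI[of _ v]) simp_all
    then show False using ind by (simp add: p_def v_def)
  qed
  then have d: "d > 0" by (simp add: d_def)
  have e1: "cmod e = 1" by (simp add: e_def)
  have ee: "e * cnj e = 1"
    using complex_norm_square[of e] e1 by simp
  \<comment> \<open>The curve takes its phase from the coordinate of \<open>p\<close> at
    \<open>k\<close>, which is \<open>h\<close> times the positive number \<open>nk\<close>; hence
    \<open>e\<close> is also the phase of \<open>h\<close>.\<close>
  have he: "h = of_real r * e"
  proof -
    have co: "coord E p k = of_real nk * h"
      unfolding nk_def h_def v_def by (rule coord_eq_hinner_principal_vec[OF S gen pS])
    have "h \<noteq> 0" using r by (auto simp: r_def)
    then have "coord E p k = of_real (cmod (coord E p k)) * e"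
      using co njk Arg_eq[of "coord E p k"] by (simp add: e_def)
    then have "of_real nk * h = of_real nk * (of_real r * e)"
      using njk by (simp add: co norm_mult r_def)
    then show ?thesis using njk by simp
  qed
  have vp: "hinner v p = cnj h" unfolding h_def by (rule hinner_commute)
  have up: "hinner u p = 0"
    by (simp add: u_def hinner_simps hinner_self np)
  have uu: "u \<in> S"
    unfolding u_def by (intro vec.subspace_diff[OF S] vec.subspace_scale[OF S] pS vS)
  then have qS: "q \<in> S"
    unfolding q_def scaleR_eq_scale by (intro vec.subspace_scale[OF S])
  have nq: "norm q = 1" using d by (simp add: q_def norm_scale e1 d_def)
  have qp: "hinner q p = 0" by (simp add: q_def scaleR_eq_scale hinner_simps up)
  have pq: "hinner p q = 0" using hinner_commute[of p q] qp by simp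
  have v: "v = cnj h *s p + (of_real d * cnj e) *s q"
  proof -
    have "(of_real d * cnj e) *s q = (of_real d * (e * cnj e) * of_real (inverse d)) *s u"
      by (simp add: q_def scaleR_eq_scale vector_smult_assoc mult_ac)
    also have "\<dots> = u" using d by (simp add: ee)
    finally show ?thesis by (simp add: u_def vp)
  qed
  \<comment> \<open>Both coefficients of \<open>v\<close> in \<open>p\<close> and \<open>q\<close>
    carry the phase \<open>cnj e\<close>. It factors out and leaves the real weights
    \<open>r\<close> and \<open>d\<close>; this is the purpose of the phase in the curve.\<close>
  have xv: "cmod (hinner x v) = cmod (of_real r * hinner x p + of_real d * hinner x q)" for x
  proof -
    have "hinner x v = e * (of_real r * hinner x p + of_real d * hinner x q)"
      by (subst v) (simp add: hinner_simps he algebra_simps)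
    then show ?thesis by (simp add: norm_mult e1)
  qed
  have rd: "r\<^sup>2 + d\<^sup>2 = 1"
  proof -
    have "hinner v p = of_real r * cnj e" using vp he by simp
    moreover have "hinner v q = of_real d * cnj e"
      by (subst v) (simp add: hinner_simps hinner_self nq pq)
    moreover have "v - hinner v p *s p - hinner v q *s q = 0"
      using v vp calculation(2) by simp
    ultimately show ?thesis
      using norm_orthonormal_decomposition[OF np nq pq, of v] r d
      by (simp add: nv norm_mult e1)
  qed
  have yp: "hinner y p = of_real c" and yq: "hinner y q = of_real s"
    by (simp_all add: y hinner_simps hinner_self np nq pq qp)
  have yS: "y \<in> S"
    unfolding y by (intro vec.subspace_add[OF S] vec.subspace_scale[OF S] pS qS)
  have ny: "norm y = 1"
  proof -
    have "(norm y)\<^sup>2 = 1"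
      using norm_orthonormal_decomposition[OF np nq pq, of y] cs
      unfolding yp yq y[symmetric] by (simp add: y)
    then show ?thesis using power2_eq_iff_nonneg[of "norm y" 1] by simp
  qed
  \<comment> \<open>In angles, \<open>la\<close> is sin(2\<phi> - 2t), \<open>mu\<close> is sin(2t)
    and \<open>M\<close> is the maximum. Since \<open>la\<close> is negative for t > \<phi>,
    maximality must come from the squares in \<open>gap\<close>, not from the signs of the
    weights.\<close>
  define la where "la = 2 * r * d * (c\<^sup>2 - s\<^sup>2) - 2 * (r\<^sup>2 - d\<^sup>2) * s * c"
  define mu where "mu = 2 * s * c"
  define M where "M = 2 * d * c * (r * c + d * s)"
  \<comment> \<open>The divisors cancel the factors \<open>nj\<close> and \<open>nk\<close> relating
    coordinates to inner products with \<open>p\<close> and \<open>v\<close>.\<close>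
  define f :: "real ^ 'n" where "f = (la / nj\<^sup>2) *\<^sub>R axis j 1 + (mu / nk\<^sup>2) *\<^sub>R axis k 1"
  have M: "M > 0"
    unfolding M_def using c s r d by (intro mult_pos_pos add_pos_nonneg mult_nonneg_nonneg) auto
  have f: "f \<bullet> sq_mod E x = la * (cmod (hinner x p))\<^sup>2 + mu * (cmod (hinner x v))\<^sup>2"
    if "x \<in> S" for x
  proof -
    have "coord E x j = of_real nj * hinner x p" "coord E x k = of_real nk * hinner x v"
      unfolding nj_def nk_def p_def v_def
      by (rule coord_eq_hinner_principal_vec[OF S gen that])+
    then show ?thesis
      using njk by (simp add: f_def inner_add_left inner_axis' sq_mod_def norm_mult
          power_mult_distrib)
  qed
  \<comment> \<open>Pythagoras is scaled by \<open>M\<close>; the quadratic identity rewrites the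
    part in the plane of \<open>p\<close> and \<open>q\<close>, and the residual keeps the weight
    \<open>M\<close>.\<close>
  have gap: "M = f \<bullet> sq_mod E x
      + 2 * r * d * (cmod (of_real s * hinner x p - of_real c * hinner x q))\<^sup>2
      + M * (norm (x - hinner x p *s p - hinner x q *s q))\<^sup>2"
    if "x \<in> S" "norm x = 1" for x
  proof -
    have "M = M * ((cmod (hinner x p))\<^sup>2 + (cmod (hinner x q))\<^sup>2)
        + M * (norm (x - hinner x p *s p - hinner x q *s q))\<^sup>2"
      using norm_orthonormal_decomposition[OF np nq pq, of x] that(2)
      by (simp flip: distrib_left)
    then show ?thesis
      using quadratic_form_identity[of d c r s "hinner x p" "hinner x q"]
      by (simp add: f[OF that(1)] xv la_def mu_def M_def)
  qed
  \<comment> \<open>Both error terms vanish at \<open>y\<close>, which lies in the plane with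
    coordinates \<open>c\<close> and \<open>s\<close>.\<close>
  have fy: "f \<bullet> sq_mod E y = M"
    using gap[OF yS ny] unfolding yp yq by (simp add: y mult.commute)
  \<comment> \<open>Non-orthogonality (\<open>r > 0\<close>) and linear independence
    (\<open>d > 0\<close>) make the weight of the first square strictly positive, so equality forces
    that square to vanish.\<close>
  have rd0: "2 * r * d > 0" using r d by simp
  show thesis
  proof (rule that[OF yS ny]; intro ballI impI)
    fix x assume x: "x \<in> S" "norm x = 1"
    have n: "0 \<le> 2 * r * d * (cmod (of_real s * hinner x p - of_real c * hinner x q))\<^sup>2"
      "0 \<le> M * (norm (x - hinner x p *s p - hinner x q *s q))\<^sup>2"
      using rd0 M by simp_all
    then show "f \<bullet> sq_mod E x \<le> f \<bullet> sq_mod E y"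
      using gap[OF x] fy by linarith
    assume "f \<bullet> sq_mod E x = f \<bullet> sq_mod E y"
    then have
      "2 * r * d * (cmod (of_real s * hinner x p - of_real c * hinner x q))\<^sup>2 = 0"
      "M * (norm (x - hinner x p *s p - hinner x q *s q))\<^sup>2 = 0"
      using gap[OF x] fy n by linarith+
    then have "of_real s * hinner x p - of_real c * hinner x q = 0"
      and b0: "x - hinner x p *s p - hinner x q *s q = 0"
      using r d M by simp_all
    then have a: "of_real s * hinner x p = of_real c * hinner x q" by simp
    have b: "x = hinner x p *s p + hinner x q *s q"
      using b0 by (metis diff_diff_eq eq_iff_diff_eq_0)
    have "hinner x q = (hinner x p / of_real c) * of_real s"
      using a c by (simp add: field_simps)
    then have "(hinner x p / of_real c) *s y = hinner x p *s p + hinner x q *s q"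
      using c by (simp add: y vector_add_ldistrib vector_smult_assoc)
    then show "\<exists>c. x = c *s y" using b by metis
  qed
qed

theorem theorem5p7:
  fixes E :: "'n::finite \<Rightarrow> complex ^ 'n"
    and S :: "(complex ^ 'n) set"
    and j k :: 'n
  assumes "orthonormal_basis E"
    and "vec.subspace S" and "S \<noteq> {0}" and "S \<noteq> UNIV"
    and "generic E S"
    and "principal_vec E S j \<noteq> principal_vec E S k"
    and "vec.independent {principal_vec E S j, principal_vec E S k}"
    and "hinner (principal_vec E S j) (principal_vec E S k) \<noteq> 0"
  shows "(\<forall>t\<in>{0..<pi/2}. sq_mod E (principal_curve E S j k t) extreme_point_of moment E S) \<and>
         (\<forall>s t0 w z. 0 < s \<and> s < 1 \<and> t0 \<in> {0..<pi/2} \<and>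
            w \<in> S \<and> z \<in> S \<and> norm w = 1 \<and> norm z = 1 \<and>
            s *\<^sub>R sq_mod E w + (1 - s) *\<^sub>R sq_mod E z = sq_mod E (principal_curve E S j k t0) \<longrightarrow>
            (\<exists>c. w = c *s principal_curve E S j k t0) \<and>
            (\<exists>c. z = c *s principal_curve E S j k t0))"
proof -
  note support = principal_curve_supporting_functional[OF assms(2,5-8)]
  have extreme: "sq_mod E (principal_curve E S j k t) extreme_point_of moment E S"
    if t: "t \<in> {0..<pi/2}" for t
  proof -
    let ?y = "principal_curve E S j k t"
    obtain f where yS: "?y \<in> S" and ny: "norm ?y = 1"
      and le: "\<forall>x\<in>S. norm x = 1 \<longrightarrow> f \<bullet> sq_mod E x \<le> f \<bullet> sq_mod E ?y"
      and eq: "\<forall>x\<in>S. norm x = 1 \<longrightarrow> f \<bullet> sq_mod E x = f \<bullet> sq_mod E ?y \<longrightarrow> (\<exists>c. x = c *s ?y)"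
      by (rule support[OF t]) (rule that)
    \<comment> \<open>Maximising unit vectors differ from \<open>?y\<close> only by a phase, which
      \<open>sq_mod\<close> does not see; the maximiser is therefore unique after passing to squared
      moduli.\<close>
    have "sq_mod E x = sq_mod E ?y"
      if x: "x \<in> S" "norm x = 1" "f \<bullet> sq_mod E x = f \<bullet> sq_mod E ?y" for x
    proof -
      obtain c where c: "x = c *s ?y" using eq x by blast
      then have "cmod c = 1" using x(2) ny by (simp add: norm_scale)
      then show ?thesis by (simp add: c sq_mod_scale)
    qed
    then show ?thesis
      unfolding moment_def using yS ny le
      by (intro exposed_point_convex_hull[of _ _ f]) blast+
  qed
  have main: "(\<exists>c. w = c *s principal_curve E S j k t0) \<and> (\<exists>c. z = c *s principal_curve E S j k t0)"
    if s: "0 < s" "s < 1" and t: "t0 \<in> {0..<pi/2}"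
      and w: "w \<in> S" "norm w = 1" and z: "z \<in> S" "norm z = 1"
      and comb: "s *\<^sub>R sq_mod E w + (1 - s) *\<^sub>R sq_mod E z = sq_mod E (principal_curve E S j k t0)"
    for s t0 w z
  proof -
    let ?y = "principal_curve E S j k t0"
    obtain f where "?y \<in> S" "norm ?y = 1"
      and le: "\<forall>x\<in>S. norm x = 1 \<longrightarrow> f \<bullet> sq_mod E x \<le> f \<bullet> sq_mod E ?y"
      and eq: "\<forall>x\<in>S. norm x = 1 \<longrightarrow> f \<bullet> sq_mod E x = f \<bullet> sq_mod E ?y \<longrightarrow> (\<exists>c. x = c *s ?y)"
      by (rule support[OF t]) (rule that)
    let ?m = "f \<bullet> sq_mod E ?y"
    have "s * (f \<bullet> sq_mod E w) + (1 - s) * (f \<bullet> sq_mod E z) = ?m"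
      by (subst comb[symmetric]) (simp add: inner_add_right)
    \<comment> \<open>Two nonnegative deficits with positive weights sum to zero, so
      \<open>w\<close> and \<open>z\<close> are both maximisers of the functional.\<close>
    then have "s * (?m - f \<bullet> sq_mod E w) + (1 - s) * (?m - f \<bullet> sq_mod E z) = 0"
      by (simp add: algebra_simps)
    moreover have "0 \<le> s * (?m - f \<bullet> sq_mod E w)" "0 \<le> (1 - s) * (?m - f \<bullet> sq_mod E z)"
      using le w z s by (auto intro!: mult_nonneg_nonneg)
    ultimately have "s * (?m - f \<bullet> sq_mod E w) = 0" "(1 - s) * (?m - f \<bullet> sq_mod E z) = 0"
      by linarith+
    then have "f \<bullet> sq_mod E w = ?m" "f \<bullet> sq_mod E z = ?m" using s by (simp_all add: mult_eq_0_iff)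
    then show ?thesis using eq w z by blast
  qed
  show ?thesis using extreme main by blast
qed

end
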